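(* Let $X$ be a connected topological space. Then $\mathrm{TC}^\beta_n(X)\le \mathrm{TC}^\Sigma_n(X)$ for all integers $n\ge 2$.
   Context: Let $I=[0,1]$ and $n\ge 2$. Bidirectional topological complexity: let $e\colon X^I\to X^n$ be the multi-evaluation map $\alpha\mapsto\left(\alpha(0),\alpha(\tfrac{1}{n-1}),\ldots,\alpha(\tfrac{n-2}{n-1}),\alpha(1)\right)$. The group $\mathbb{Z}_2=\langle\beta\rangle$ acts on $X^n$ by $\beta\cdot(x_1,\ldots,x_n)=(x_n,\ldots,x_1)$ and on the path space $X^I$ by $(\beta\cdot\alpha)(t)=\alpha(1-t)$, and $e$ is equivariant. $\mathrm{TC}^\beta_n(X)$ is the smallest number of open subsets $U$ with $\beta(U)=U$ that cover $X^n$ and on each of which there is a continuous $\beta$-equivariant map $s\colon U\to X^I$ with $e\circ s$ equal to the inclusion $U\hookrightarrow X^n$. Symmetrized topological complexity: let $J_n$ be the wedge of $n$ copies of $I$, each with base point $0$, so that a point of $X^{J_n}$ is an $n$-tuple of paths $(\alpha_1,\ldots,\alpha_n)$ in $X$ with $\alpha_i(0)=\alpha_j(0)$ for all $i,j$; let $e\colon X^{J_n}\to X^n$ be $(\alpha_1,\ldots,\alpha_n)\mapsto(\alpha_1(1),\ldots,\alpha_n(1))$. The symmetric group $\Sigma_n$ acts on $X^{J_n}$ and $X^n$ by permuting components. $\mathrm{TC}^\Sigma_n(X)$ is the smallest number of $\Sigma_n$-invariant open subsets $U$ covering $X^n$ on each of which there is a continuous $\Sigma_n$-equivariant map $s\colon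 U\to X^{J_n}$ with $e\circ s$ equal to the inclusion $U\hookrightarrow X^n$. Both numbers are unreduced (the number of open sets is counted), and are $\infty$ if no finite cover exists. *)

theory Defs
  imports
    "HOL-Analysis.Analysis"
    "HOL-Combinatorics.Permutations"
    "HOL-Library.Extended_Nat"
begin

(* Continuous maps K -> X with the compact-open topology. As for product_topology, a map out of
   topspace K is represented by a function that is undefined outside topspace K, so that
   distinct functions represent distinct maps. *)

definition continuous_maps :: "'k topology \<Rightarrow> 'a topology \<Rightarrow> ('k \<Rightarrow> 'a) set" where
  "continuous_maps K X = {f \<in> extensional (topspace K). continuous_map K X f}"

definition mapping_space :: "'k topology \<Rightarrow> 'a topology \<Rightarrow> ('k \<Rightarrow> 'a) topology" where
  "mapping_space K X =
     topology_generated_by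
       {{f \<in> continuous_maps K X. f ` C \<subseteq> V} | C V. compactin K C \<and> openin X V}"

lemma topspace_mapping_space [simp]: "topspace (mapping_space K X) = continuous_maps K X"
proof -
  have "continuous_maps K X \<in>
      {{f \<in> continuous_maps K X. f ` C \<subseteq> V} | C V. compactin K C \<and> openin X V}"
    by (rule CollectI, rule exI[of _ "{}"], rule exI[of _ "{}"]) auto
  then show ?thesis
    unfolding mapping_space_def topology_generated_by_topspace by blast
qed

abbreviation path_space :: "'a topology \<Rightarrow> (real \<Rightarrow> 'a) topology" where
  "path_space X \<equiv> mapping_space (top_of_set {0..1}) X"

(* Tuples are indexed by {1..n}. *)

abbreviation power_space :: "nat \<Rightarrow> 'a topology \<Rightarrow> (nat \<Rightarrow> 'a) topology" where
  "power_space n X \<equiv> product_topology (\<lambda>_. X) {1..n}"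


definition multi_eval :: "nat \<Rightarrow> (real \<Rightarrow> 'a) \<Rightarrow> nat \<Rightarrow> 'a" where
  "multi_eval n \<alpha> = (\<lambda>i\<in>{1..n}. \<alpha> ((real i - 1) / (real n - 1)))"

definition reverse_tuple :: "nat \<Rightarrow> (nat \<Rightarrow> 'a) \<Rightarrow> nat \<Rightarrow> 'a" where
  "reverse_tuple n x = (\<lambda>i\<in>{1..n}. x (n + 1 - i))"

definition reverse_path :: "(real \<Rightarrow> 'a) \<Rightarrow> real \<Rightarrow> 'a" where
  "reverse_path \<alpha> = (\<lambda>t\<in>{0..1}. \<alpha> (1 - t))"

definition beta_domain :: "nat \<Rightarrow> 'a topology \<Rightarrow> (nat \<Rightarrow> 'a) set \<Rightarrow> bool" where
  "beta_domain n X U \<longleftrightarrow>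
     openin (power_space n X) U \<and>
     reverse_tuple n ` U = U \<and>
     (\<exists>s. continuous_map (subtopology (power_space n X) U) (path_space X) s \<and>
          (\<forall>x\<in>U. s (reverse_tuple n x) = reverse_path (s x)) \<and>
          (\<forall>x\<in>U. multi_eval n (s x) = x))"

definition TC_beta :: "nat \<Rightarrow> 'a topology \<Rightarrow> enat" where
  "TC_beta n X =
     Inf {enat (card \<U>) | \<U>. finite \<U> \<and> \<Union>\<U> = topspace (power_space n X) \<and>
                             (\<forall>U\<in>\<U>. beta_domain n X U)}"


(* Maps out of the wedge J_n of n intervals, as n-tuples of paths with a common initial point.
   Since J_n is a finite wedge, a subset of J_n is compact iff its trace on each copy of the
   interval is, so the compact-open topology is the one induced from the n-fold product of the
   path space. *)

definition wedge_path_space :: "nat \<Rightarrow> 'a topology \<Rightarrow> (nat \<Rightarrow> real \<Rightarrow> 'a) topology" where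
  "wedge_path_space n X =
     subtopology (power_space n (path_space X)) {\<alpha>. \<forall>i\<in>{1..n}. \<forall>j\<in>{1..n}. \<alpha> i 0 = \<alpha> j 0}"

definition endpoint_eval :: "nat \<Rightarrow> (nat \<Rightarrow> real \<Rightarrow> 'a) \<Rightarrow> nat \<Rightarrow> 'a" where
  "endpoint_eval n \<alpha> = (\<lambda>i\<in>{1..n}. \<alpha> i 1)"

(* The left action of a permutation \<sigma> of {1..n} on n-tuples of any kind. *)

definition permute_tuple :: "nat \<Rightarrow> (nat \<Rightarrow> nat) \<Rightarrow> (nat \<Rightarrow> 'b) \<Rightarrow> nat \<Rightarrow> 'b" where
  "permute_tuple n \<sigma> x = (\<lambda>i\<in>{1..n}. x (inv \<sigma> i))"

definition Sigma_domain :: "nat \<Rightarrow> 'a topology \<Rightarrow> (nat \<Rightarrow> 'a) set \<Rightarrow> bool" where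
  "Sigma_domain n X U \<longleftrightarrow>
     openin (power_space n X) U \<and>
     (\<forall>\<sigma>. \<sigma> permutes {1..n} \<longrightarrow> permute_tuple n \<sigma> ` U = U) \<and>
     (\<exists>s. continuous_map (subtopology (power_space n X) U) (wedge_path_space n X) s \<and>
          (\<forall>\<sigma>. \<sigma> permutes {1..n} \<longrightarrow>
             (\<forall>x\<in>U. s (permute_tuple n \<sigma> x) = permute_tuple n \<sigma> (s x))) \<and>
          (\<forall>x\<in>U. endpoint_eval n (s x) = x))"

definition TC_Sigma :: "nat \<Rightarrow> 'a topology \<Rightarrow> enat" where
  "TC_Sigma n X =
     Inf {enat (card \<U>) | \<U>. finite \<U> \<and> \<Union>\<U> = topspace (power_space n X) \<and>
                             (\<forall>U\<in>\<U>. Sigma_domain n X U)}"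

end

theory Submission
  imports Defs
begin

text \<open>
  The claim holds cover by cover: every \<open>\<Sigma>\<^sub>n\<close>-invariant open set that carries an equivariant
  section of the wedge evaluation also carries a \<open>\<beta>\<close>-equivariant section of the multi-evaluation,
  so the infimum defining \<open>TC_beta\<close> runs over at least the covers that define \<open>TC_Sigma\<close>.

  The section is obtained by a natural construction on tuples of paths. Think of
  \<open>(\<alpha>\<^sub>1, \<dots>, \<alpha>\<^sub>n)\<close> with common origin as a spider whose feet are the points
  \<open>\<alpha>\<^sub>i(1) = x\<^sub>i\<close>. Start at the first foot and visit the feet in order: run back along the current
  leg to the body, out along the next leg, and so on, at constant speed. This path is at \<open>x\<^sub>i\<close> at time
  \<open>(i-1)/(n-1)\<close> and at the body halfway between two such times. Its time reversal visits the same
  feet in the opposite order, hence is the path of the spider with legs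
  \<open>(\<alpha>\<^sub>n, \<dots>, \<alpha>\<^sub>1)\<close>. As the tuple reversal \<open>\<beta>\<close> is one of the permutations in \<open>\<Sigma>\<^sub>n\<close>,
  equivariance under \<open>\<Sigma>\<^sub>n\<close> of the given section yields equivariance under \<open>\<beta>\<close> of the new one.

  Continuity is checked after adjunction: since \<open>[0,1]\<close> is compact Hausdorff, a map from \<open>Y\<close> to the
  path space with the compact-open topology is continuous exactly if the adjoint map
  \<open>Y \<times> [0,1] \<rightarrow> X\<close> is (\<open>continuous_map_eval_mapping_space\<close> and
  \<open>continuous_map_curry_mapping_space\<close>), for an arbitrary space \<open>X\<close>. The adjoint of the spider
  path is pasted from finitely many closed pieces, one for each leg.
\<close>

section \<open>The exponential law for the compact-open topology\<close>

text \<open>If \<open>f\<close> is continuous and \<open>f k\<close> lies in an open set \<open>V\<close>, local compactness supplies a compact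
  neighbourhood \<open>C\<close> of \<open>k\<close> with \<open>f(C) \<subseteq> V\<close>. The maps that send \<open>C\<close> into \<open>V\<close> form a subbasic open set,
  and evaluation maps the product of this set with \<open>C\<close> into \<open>V\<close>.\<close>

lemma continuous_map_eval_mapping_space:
  assumes "locally_compact_space K" "Hausdorff_space K"
  shows "continuous_map (prod_topology (mapping_space K X) K) X (\<lambda>(f, k). f k)"
  unfolding continuous_map_def
proof (intro conjI allI impI)
  show "(\<lambda>(f, k). f k) \<in> topspace (prod_topology (mapping_space K X) K) \<rightarrow> topspace X"
    by (auto simp: continuous_maps_def continuous_map_def)
next
  fix V assume V: "openin X V"
  let ?W = "{p \<in> topspace (prod_topology (mapping_space K X) K). (case p of (f, k) \<Rightarrow> f k) \<in> V}"
  have base: "neighbourhood_base_of (compactin K) K"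
    using assms locally_compact_space_neighbourhood_base by blast
  have "\<exists>A B. openin (mapping_space K X) A \<and> openin K B \<and> f \<in> A \<and> k \<in> B \<and> A \<times> B \<subseteq> ?W"
    if fk: "(f, k) \<in> ?W" for f k
  proof -
    have f: "f \<in> continuous_maps K X" "continuous_map K X f" and k: "k \<in> topspace K" "f k \<in> V"
      using fk by (auto simp: continuous_maps_def)
    have "openin K {x \<in> topspace K. f x \<in> V}"
      using f V by (simp add: openin_continuous_map_preimage)
    then obtain B C where B: "openin K B" "compactin K C" "k \<in> B" "B \<subseteq> C"
        "C \<subseteq> {x \<in> topspace K. f x \<in> V}"
      using base k unfolding neighbourhood_base_of by (metis (mono_tags, lifting) mem_Collect_eq)
    let ?A = "{g \<in> continuous_maps K X. g ` C \<subseteq> V}"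
    have "openin (mapping_space K X) ?A"
      unfolding mapping_space_def using B V by (intro topology_generated_by_Basis) blast
    moreover have "f \<in> ?A" "?A \<times> B \<subseteq> ?W"
      using f B openin_subset[OF B(1)] by (auto simp: image_subset_iff subset_iff)
    ultimately show ?thesis
      using B by blast
  qed
  then show "openin (prod_topology (mapping_space K X) K) ?W"
    unfolding openin_prod_topology_alt by blast
qed

text \<open>By the tube lemma, a map that sends \<open>{y} \<times> C\<close> into an open set, with \<open>C\<close> compact, does so for
  all nearby \<open>y\<close>.\<close>

lemma continuous_map_curry_mapping_space:
  assumes F: "continuous_map (prod_topology Y K) X F"
  shows "continuous_map Y (mapping_space K X) (\<lambda>y. \<lambda>k\<in>topspace K. F (y, k))"
    (is "continuous_map Y _ ?c")
proof -
  have cm: "?c y \<in> continuous_maps K X" if "y \<in> topspace Y" for y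
  proof -
    have "continuous_map K (prod_topology Y K) (\<lambda>k. (y, k))"
      using that by (simp add: continuous_map_pairedI)
    then have "continuous_map K X (F \<circ> (\<lambda>k. (y, k)))"
      using F by (rule continuous_map_compose)
    then have "continuous_map K X (?c y)"
      by (rule continuous_map_eq) auto
    then show ?thesis
      by (simp add: continuous_maps_def)
  qed
  have "openin Y (?c -` {f \<in> continuous_maps K X. f ` C \<subseteq> V} \<inter> topspace Y)" (is "openin Y ?P")
    if C: "compactin K C" and V: "openin X V" for C V
  proof (subst openin_subopen, intro ballI)
    fix y assume y: "y \<in> ?P"
    have CK: "C \<subseteq> topspace K"
      using C by (rule compactin_subset_topspace)
    let ?W = "{p \<in> topspace (prod_topology Y K). F p \<in> V}"
    have "openin (prod_topology Y K) ?W"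
      using F V by (rule openin_continuous_map_preimage)
    moreover have "compactin Y {y}"
      using y by simp
    moreover have "{y} \<times> C \<subseteq> ?W"
      using y CK by (auto simp: subset_iff image_iff)
    ultimately obtain A B where AB: "openin Y A" "{y} \<subseteq> A" "C \<subseteq> B" "A \<times> B \<subseteq> ?W"
      using C by (elim Wallace_theorem_prod_topology[rotated 2])
    have "A \<subseteq> ?P"
    proof
      fix a assume a: "a \<in> A"
      then have "a \<in> topspace Y"
        using AB(1) openin_subset by blast
      moreover have "F (a, k) \<in> V" if "k \<in> C" for k
        using AB a that by blast
      ultimately show "a \<in> ?P"
        using cm CK by auto
    qed
    then show "\<exists>T. openin Y T \<and> y \<in> T \<and> T \<subseteq> ?P"
      using AB by auto
  qed
  moreover have "?c ` topspace Y \<subseteq> topspace (mapping_space K X)"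
    using cm by auto
  ultimately show ?thesis
    unfolding mapping_space_def continuous_on_generated_topo_iff topology_generated_by_topspace
    by blast
qed

section \<open>The path of a spider\<close>

text \<open>Position on the \<open>i\<close>-th leg at time \<open>t\<close>: \<open>1\<close> at the time \<open>(i-1)/(n-1)\<close> at which the \<open>i\<close>-th foot is
  visited, decreasing linearly on both sides, and \<open>0\<close> half a step away. It is negative exactly
  when a different leg is being walked.\<close>

definition leg_position :: "nat \<Rightarrow> nat \<Rightarrow> real \<Rightarrow> real" where
  "leg_position n i t = 1 - 2 * \<bar>(real n - 1) * t - (real i - 1)\<bar>"

text \<open>The choice of the leg is ambiguous only at the times spent in the body, where legs with a common
  origin agree.\<close>

definition spider_path :: "nat \<Rightarrow> (nat \<Rightarrow> real \<Rightarrow> 'a) \<Rightarrow> real \<Rightarrow> 'a" where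
  "spider_path n \<alpha> =
     (\<lambda>t\<in>{0..1}. let i = SOME i. i \<in> {1..n} \<and> 0 \<le> leg_position n i t in \<alpha> i (leg_position n i t))"

lemma leg_position_le_1: "leg_position n i t \<le> 1"
  by (simp add: leg_position_def)

text \<open>The leg in use is found by rounding \<open>u = (n-1) t\<close> to the nearest integer; the index is shifted by
  one because the first foot is visited at time \<open>0\<close>.\<close>

lemma ex_leg:
  assumes "n \<ge> 2" "t \<in> {0..1}"
  shows "\<exists>i\<in>{1..n}. 0 \<le> leg_position n i t"
proof -
  define u where "u = (real n - 1) * t"
  have u: "0 \<le> u" "u \<le> real n - 1"
    using assms mult_left_le[of t "real n - 1"] by (auto simp: u_def)
  define i where "i = nat \<lfloor>u + 1/2\<rfloor> + 1"
  have fl: "\<lfloor>u + 1/2\<rfloor> \<ge> 0" "\<lfloor>u + 1/2\<rfloor> < int n"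
    using u by (simp, linarith)
  then have "i \<in> {1..n}"
    unfolding i_def atLeastAtMost_iff by linarith
  moreover have "real i - 1 = of_int \<lfloor>u + 1/2\<rfloor>"
    using fl by (simp add: i_def)
  then have "\<bar>u - (real i - 1)\<bar> \<le> 1/2"
    by linarith
  then have "0 \<le> leg_position n i t"
    by (simp add: leg_position_def u_def)
  ultimately show ?thesis
    by blast
qed

text \<open>In the time scale \<open>u = (n-1) t\<close> distinct feet are visited at least one unit apart, while a leg is
  walked only up to half a unit before and after the visit to its foot. Two legs can therefore
  compete only at the common boundary of their time intervals.\<close>

lemma leg_position_conflict:
  assumes "0 \<le> leg_position n i t" "0 \<le> leg_position n j t" "i \<noteq> j"
  shows "leg_position n i t = 0"
proof -
  have "1 \<le> \<bar>real i - real j\<bar>"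
    using assms(3) by linarith
  moreover define a where "a = (real n - 1) * t - (real i - 1)"
  moreover define b where "b = (real n - 1) * t - (real j - 1)"
  ultimately have "1 \<le> \<bar>a\<bar> + \<bar>b\<bar>"
    by linarith
  moreover have "\<bar>a\<bar> \<le> 1/2" "\<bar>b\<bar> \<le> 1/2"
    using assms(1,2) by (simp_all add: leg_position_def a_def b_def)
  ultimately have "\<bar>a\<bar> = 1/2"
    by linarith
  then show ?thesis
    by (simp add: leg_position_def a_def)
qed

definition common_origin :: "nat \<Rightarrow> (nat \<Rightarrow> real \<Rightarrow> 'a) \<Rightarrow> bool" where
  "common_origin n \<alpha> \<longleftrightarrow> (\<forall>i\<in>{1..n}. \<forall>j\<in>{1..n}. \<alpha> i 0 = \<alpha> j 0)"

lemma common_origin_wedge_path_space: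
  "\<alpha> \<in> topspace (wedge_path_space n X) \<Longrightarrow> common_origin n \<alpha>"
  unfolding wedge_path_space_def common_origin_def topspace_subtopology by blast

lemma leg_agreement:
  assumes "common_origin n \<alpha>"
    and "i \<in> {1..n}" "j \<in> {1..n}" "0 \<le> leg_position n i t" "0 \<le> leg_position n j t"
  shows "\<alpha> i (leg_position n i t) = \<alpha> j (leg_position n j t)"
proof (cases "i = j")
  case False
  then have "leg_position n i t = 0" "leg_position n j t = 0"
    using assms leg_position_conflict by blast+
  then show ?thesis
    using assms(1-3) unfolding common_origin_def by metis
qed simp

lemma spider_path_eq:
  assumes "common_origin n \<alpha>"
    and "t \<in> {0..1}" "i \<in> {1..n}" "0 \<le> leg_position n i t"
  shows "spider_path n \<alpha> t = \<alpha> i (leg_position n i t)"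
proof -
  define j where "j = (SOME j. j \<in> {1..n} \<and> 0 \<le> leg_position n j t)"
  have "j \<in> {1..n} \<and> 0 \<le> leg_position n j t"
    unfolding j_def by (rule someI[of _ i]) (use assms in simp)
  then have "\<alpha> j (leg_position n j t) = \<alpha> i (leg_position n i t)"
    using leg_agreement[OF assms(1), of j i t] assms(3,4) by blast
  then show ?thesis
    using assms(2) by (simp add: spider_path_def j_def Let_def)
qed

text \<open>At the time \<open>(i-1)/(n-1)\<close> the path has reached the end of the \<open>i\<close>-th leg, so it turns a section of
  the wedge evaluation into a section of the multi-evaluation.\<close>

lemma multi_eval_spider_path:
  assumes "n \<ge> 2" "common_origin n \<alpha>"
  shows "multi_eval n (spider_path n \<alpha>) = endpoint_eval n \<alpha>"
proof -
  have "spider_path n \<alpha> ((real i - 1) / (real n - 1)) = \<alpha> i 1" if "i \<in> {1..n}" for i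
  proof -
    have "leg_position n i ((real i - 1) / (real n - 1)) = 1"
      using assms(1) by (simp add: leg_position_def)
    moreover have "(real i - 1) / (real n - 1) \<in> {0..1}"
      using assms(1) that by auto
    ultimately show ?thesis
      using spider_path_eq[OF assms(2)] that by simp
  qed
  then show ?thesis
    unfolding multi_eval_def endpoint_eval_def by (intro restrict_ext) simp
qed

lemma leg_position_reverse:
  assumes "i \<in> {1..n}"
  shows "leg_position n i (1 - t) = leg_position n (n + 1 - i) t"
proof -
  have "(real n - 1) * (1 - t) - (real i - 1) = - ((real n - 1) * t - (real (n + 1 - i) - 1))"
    using assms by (simp add: of_nat_diff algebra_simps)
  then show ?thesis
    unfolding leg_position_def by (metis abs_minus_cancel)
qed

text \<open>Running the path backwards visits the same feet in the opposite order, and within each leg the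
  schedule is symmetric about the visit to the foot.\<close>

lemma spider_path_reverse_tuple:
  assumes "n \<ge> 2" "common_origin n \<alpha>"
  shows "spider_path n (reverse_tuple n \<alpha>) = reverse_path (spider_path n \<alpha>)"
proof
  fix t :: real
  have mirror: "n + 1 - i \<in> {1..n}" if "i \<in> {1..n}" for i
    using that by auto
  have common: "common_origin n (reverse_tuple n \<alpha>)"
    unfolding common_origin_def
  proof (intro ballI)
    fix i j assume "i \<in> {1..n}" "j \<in> {1..n}"
    moreover from this have "\<alpha> (n + 1 - i) 0 = \<alpha> (n + 1 - j) 0"
      using assms(2) mirror unfolding common_origin_def by blast
    ultimately show "reverse_tuple n \<alpha> i 0 = reverse_tuple n \<alpha> j 0"
      by (simp add: reverse_tuple_def)
  qed
  show "spider_path n (reverse_tuple n \<alpha>) t = reverse_path (spider_path n \<alpha>) t"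
  proof (cases "t \<in> {0..1}")
    case True
    then obtain i where i: "i \<in> {1..n}" "0 \<le> leg_position n i t"
      using ex_leg assms(1) by blast
    have "leg_position n (n + 1 - i) (1 - t) = leg_position n i t"
      using leg_position_reverse[OF mirror[OF i(1)], of t] i(1) by simp
    moreover have "1 - t \<in> {0..1}"
      using True by simp
    ultimately have "spider_path n \<alpha> (1 - t) = \<alpha> (n + 1 - i) (leg_position n i t)"
      using spider_path_eq[OF assms(2), of "1 - t" "n + 1 - i"] mirror[OF i(1)] i(2) by simp
    also have "\<dots> = spider_path n (reverse_tuple n \<alpha>) t"
      using spider_path_eq[OF common True i] i(1) by (simp add: reverse_tuple_def)
    finally show ?thesis
      using True by (simp add: reverse_path_def)
  qed (unfold spider_path_def reverse_path_def restrict_def, metis)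
qed

section \<open>Continuity of the spider path\<close>

text \<open>On the closed set where the \<open>i\<close>-th leg is in use, the adjoint of the spider path is evaluation of
  the \<open>i\<close>-th path at a point depending continuously on the time. The restriction keeps that point in
  the domain of the path.\<close>

lemma continuous_map_leg:
  assumes "continuous_map Y (path_space X) a"
  shows "continuous_map
           (subtopology (prod_topology Y (top_of_set {0..1})) {p. 0 \<le> leg_position n i (snd p)}) X
           (\<lambda>p. a (fst p) (leg_position n i (snd p)))"
    (is "continuous_map ?Z X _")
proof -
  have fst: "continuous_map ?Z (path_space X) (\<lambda>p. a (fst p))"
    using continuous_map_from_subtopology
      [OF continuous_map_compose[OF continuous_map_fst[of Y "top_of_set {0..1}"] assms]]
    by (simp add: comp_def)
  have "continuous_map (prod_topology Y (top_of_set {0..1::real})) euclideanreal snd"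
    using continuous_map_snd continuous_map_in_subtopology by blast
  then have "continuous_map ?Z euclideanreal snd"
    by (rule continuous_map_from_subtopology)
  then have "continuous_map ?Z euclideanreal (\<lambda>p. leg_position n i (snd p))"
    unfolding leg_position_def by (intro continuous_intros) auto
  then have snd: "continuous_map ?Z (top_of_set {0..1}) (\<lambda>p. leg_position n i (snd p))"
    by (auto simp: continuous_map_in_subtopology leg_position_le_1)
  have "continuous_map (prod_topology (path_space X) (top_of_set {0..1})) X (\<lambda>(f, k). f k)"
    by (intro continuous_map_eval_mapping_space compact_imp_locally_compact_space
        Hausdorff_space_subtopology)
      (auto simp: compact_space_subtopology)
  from continuous_map_compose[OF continuous_map_pairedI[OF fst snd] this]
  show ?thesis
    by (simp add: comp_def)
qed

lemma continuous_map_spider_path: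
  assumes "n \<ge> 2" and s: "continuous_map Y (wedge_path_space n X) s"
  shows "continuous_map Y (path_space X) (\<lambda>y. spider_path n (s y))"
proof -
  let ?Z = "prod_topology Y (top_of_set {0..1::real})"
  let ?T = "\<lambda>i. topspace ?Z \<inter> {p. 0 \<le> leg_position n i (snd p)}"
  have common: "common_origin n (s y)" if "y \<in> topspace Y" for y
    using continuous_map_image_subset_topspace[OF s] that common_origin_wedge_path_space by blast
  have comp: "continuous_map Y (path_space X) (\<lambda>y. s y i)" if "i \<in> {1..n}" for i
    using s that unfolding wedge_path_space_def continuous_map_in_subtopology
      continuous_map_componentwise by blast
  have "continuous_map ?Z X (\<lambda>p. spider_path n (s (fst p)) (snd p))"
  proof (rule pasting_lemma_closed)
    show "finite {1..n}"
      by simp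
    show "closedin ?Z (?T i)" for i
    proof -
      have "continuous_map ?Z euclideanreal snd"
        using continuous_map_snd continuous_map_in_subtopology by blast
      then have "continuous_map ?Z euclideanreal (\<lambda>p. leg_position n i (snd p))"
        unfolding leg_position_def by (intro continuous_intros) auto
      from closedin_continuous_map_preimage[OF this, of "{0..}"] show ?thesis
        by (simp add: Int_def)
    qed
    show "continuous_map (subtopology ?Z (?T i)) X (\<lambda>p. s (fst p) i (leg_position n i (snd p)))"
      if "i \<in> {1..n}" for i
      using continuous_map_leg[OF comp[OF that]] by (metis subtopology_restrict)
    show "s (fst p) i (leg_position n i (snd p)) = s (fst p) j (leg_position n j (snd p))"
      if "i \<in> {1..n}" "j \<in> {1..n}" "p \<in> topspace ?Z \<inter> ?T i \<inter> ?T j" for i j p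
    proof -
      have "fst p \<in> topspace Y"
        using that(3) by auto
      then show ?thesis
        using leg_agreement[OF common, of "fst p" i j "snd p"] that by blast
    qed
    show "\<exists>i. i \<in> {1..n} \<and> p \<in> ?T i \<and>
            spider_path n (s (fst p)) (snd p) = s (fst p) i (leg_position n i (snd p))"
      if p: "p \<in> topspace ?Z" for p
    proof -
      have p': "fst p \<in> topspace Y" "snd p \<in> {0..1}"
        using p by auto
      then obtain i where "i \<in> {1..n}" "0 \<le> leg_position n i (snd p)"
        using ex_leg assms(1) by blast
      then show ?thesis
        using spider_path_eq[OF common] p p' by blast
    qed
  qed
  from continuous_map_curry_mapping_space[OF this]
  have "continuous_map Y (path_space X) (\<lambda>y. \<lambda>t\<in>{0..1}. spider_path n (s y) t)"
    by simp
  then show ?thesis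
    by (simp add: spider_path_def restrict_def cong: if_cong)
qed

section \<open>Comparison of the two covering numbers\<close>

definition reversal :: "nat \<Rightarrow> nat \<Rightarrow> nat" where
  "reversal n i = (if i \<in> {1..n} then n + 1 - i else i)"

lemma reversal_involution: "reversal n (reversal n i) = i"
  by (auto simp: reversal_def)

lemma reversal_permutes: "reversal n permutes {1..n}"
  unfolding permutes_def using reversal_involution by (metis reversal_def)

lemma permute_tuple_reversal: "permute_tuple n (reversal n) = reverse_tuple n"
proof
  fix x :: "nat \<Rightarrow> 'b"
  have "inv (reversal n) = reversal n"
    by (intro inv_equality) (simp_all add: reversal_involution)
  then show "permute_tuple n (reversal n) x = reverse_tuple n x"
    unfolding permute_tuple_def reverse_tuple_def by (intro restrict_ext) (simp add: reversal_def)
qed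

text \<open>The reversal is one of the permutations, so the given section \<open>s\<close> is in particular
  \<open>\<beta>\<close>-equivariant; following it by the \<open>\<beta>\<close>-equivariant map \<open>spider_path\<close> gives the section sought,
  on the same open set.\<close>

lemma Sigma_domain_imp_beta_domain:
  assumes "n \<ge> 2" "Sigma_domain n X U"
  shows "beta_domain n X U"
proof -
  obtain s where s: "continuous_map (subtopology (power_space n X) U) (wedge_path_space n X) s"
      and equi: "\<And>\<sigma> x. \<lbrakk>\<sigma> permutes {1..n}; x \<in> U\<rbrakk> \<Longrightarrow> s (permute_tuple n \<sigma> x) = permute_tuple n \<sigma> (s x)"
      and sec: "\<And>x. x \<in> U \<Longrightarrow> endpoint_eval n (s x) = x"
    using assms(2) unfolding Sigma_domain_def by blast
  have U: "openin (power_space n X) U"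
      "\<And>\<sigma>. \<sigma> permutes {1..n} \<Longrightarrow> permute_tuple n \<sigma> ` U = U"
    using assms(2) unfolding Sigma_domain_def by blast+
  have rev: "reverse_tuple n ` U = U"
    using U(2)[OF reversal_permutes] by (simp add: permute_tuple_reversal)
  have s_rev: "s (reverse_tuple n x) = reverse_tuple n (s x)" if "x \<in> U" for x
    using equi[OF reversal_permutes that] by (simp add: permute_tuple_reversal)
  have common: "common_origin n (s x)" if "x \<in> U" for x
  proof -
    have "x \<in> topspace (subtopology (power_space n X) U)"
      using openin_subset[OF U(1)] that by auto
    then show ?thesis
      using continuous_map_image_subset_topspace[OF s] common_origin_wedge_path_space by blast
  qed
  show ?thesis
    unfolding beta_domain_def
  proof (intro conjI exI[of _ "\<lambda>x. spider_path n (s x)"] ballI)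
    show "continuous_map (subtopology (power_space n X) U) (path_space X) (\<lambda>x. spider_path n (s x))"
      using assms(1) s by (rule continuous_map_spider_path)
    show "spider_path n (s (reverse_tuple n x)) = reverse_path (spider_path n (s x))" if "x \<in> U" for x
      using that assms(1) common s_rev spider_path_reverse_tuple by metis
    show "multi_eval n (spider_path n (s x)) = x" if "x \<in> U" for x
      using that assms(1) common sec multi_eval_spider_path by metis
  qed (use U rev in auto)
qed

theorem proposition2p4:
  fixes X :: "'a topology" and n :: nat
  assumes "connected_space X"
    and "n \<ge> 2"
  shows "TC_beta n X \<le> TC_Sigma n X"
  unfolding TC_beta_def TC_Sigma_def
  by (rule Inf_superset_mono) (use Sigma_domain_imp_beta_domain[OF assms(2)] in blast)

end
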